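(* Let $f$, $P_1$, $P_2$, $P=P_1-P_2$, $F=f+P$ and $L>0$ satisfy the standing assumptions given in the context (in particular $F$ is level-bounded), and let $\{x^t\}$ be a sequence generated by ${\rm pDCA}_e$ (defined in the context) for solving $\min_{x\in\mathbb{R}^n}F(x)$. Then the following statements hold. (i) The sequence $\{x^t\}$ is bounded. (ii) $\lim_{t\to\infty}\|x^{t+1}-x^t\|=0$. (iii) Any accumulation point of $\{x^t\}$ is a stationary point of $F$.
   Context: Notation: $\mathbb{R}^n$ carries the inner product $\langle\cdot,\cdot\rangle$ and Euclidean norm $\|\cdot\|$. For an extended-real-valued function $h$, $\mathrm{dom}\,h=\{x: h(x)<\infty\}$; $h$ is proper if it never equals $-\infty$ and $\mathrm{dom}\,h\neq\emptyset$; a proper function is closed if it is lower semicontinuous; a proper closed $h$ is level-bounded if $\{x: h(x)\le r\}$ is bounded for every $r\in\mathbb{R}$. For convex $h$, $\partial h(x)=\{v: h(u)-h(x)-\langle v,u-x\rangle\ge 0\ \ \forall u\in\mathbb{R}^n\}$. Standing assumptions: $F(x)=f(x)+P(x)$ with $P(x)=P_1(x)-P_2(x)$, where $f:\mathbb{R}^n\to\mathbb{R}$ is a smooth convex function whose gradient is Lipschitz continuous with modulus $L>0$, $P_1:\mathbb{R}^n\to(-\infty,\infty]$ is proper closed convex, $P_2:\mathbb{R}^n\to\mathbb{R}$ is a continuous convex function, and $F$ is level-bounded. Algorithm ${\rm pDCA}_e$ (proximal difference-of-convex algorithm with extrapolation): the input is $x^0\in\mathrm{dom}\,P_1$ and $\{\beta_t\}\subseteq[0,1)$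 with $\sup_t\beta_t<1$. Set $x^{-1}=x^0$. For $t=0,1,2,\dots$, take any $\xi^t\in\partial P_2(x^t)$ and set $$y^t=x^t+\beta_t(x^t-x^{t-1}),\qquad x^{t+1}=\operatorname{arg\,min}_{y\in\mathbb{R}^n}\Big\{\langle\nabla f(y^t)-\xi^t,y\rangle+\tfrac{L}{2}\|y-y^t\|^2+P_1(y)\Big\}.$$ Stationary point: $\bar x$ is a stationary point of $F$ if $0\in\nabla f(\bar x)+\partial P_1(\bar x)-\partial P_2(\bar x)$ (Minkowski sum and difference of sets). *)

theory Defs
  imports "HOL-Analysis.Analysis"
begin

definition edom :: "('a \<Rightarrow> ereal) \<Rightarrow> 'a set" where
  "edom h = {x. h x < \<infinity>}"

definition proper_fun :: "('a \<Rightarrow> ereal) \<Rightarrow> bool" where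
  "proper_fun h \<longleftrightarrow> (\<forall>x. h x \<noteq> - \<infinity>) \<and> edom h \<noteq> {}"

definition lower_semicontinuous :: "('a::topological_space \<Rightarrow> ereal) \<Rightarrow> bool" where
  "lower_semicontinuous h \<longleftrightarrow> (\<forall>x. h x \<le> Liminf (at x) h)"

text \<open>Closedness, as used here, is a notion for proper functions.\<close>

definition proper_closed :: "('a::topological_space \<Rightarrow> ereal) \<Rightarrow> bool" where
  "proper_closed h \<longleftrightarrow> proper_fun h \<and> lower_semicontinuous h"

text \<open>Convexity of the epigraph; the library's \<open>convex_on\<close> covers real-valued functions only.\<close>

definition convex_ereal :: "('a::real_vector \<Rightarrow> ereal) \<Rightarrow> bool" where
  "convex_ereal h \<longleftrightarrow> convex {(x, r::real). h x \<le> ereal r}"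

definition level_bounded :: "('a::metric_space \<Rightarrow> ereal) \<Rightarrow> bool" where
  "level_bounded h \<longleftrightarrow> (\<forall>r::real. bounded {x. h x \<le> ereal r})"

text \<open>For proper \<open>h\<close> this set is empty at every \<open>x\<close> outside \<open>edom h\<close>: choosing \<open>u\<close> in the
  domain makes \<open>h u - h x = - \<infinity>\<close>. The convention \<open>\<infinity> - \<infinity> = \<infinity>\<close> of \<open>ereal\<close> therefore
  does no harm.\<close>

definition subdifferential :: "('a::real_inner \<Rightarrow> ereal) \<Rightarrow> 'a \<Rightarrow> 'a set" where
  "subdifferential h x = {v. \<forall>u. h u - h x - ereal (inner v (u - x)) \<ge> 0}"

text \<open>Meaningful only where \<open>f\<close> is differentiable; there the gradient exists and is unique.\<close>

definition gradient :: "('a::real_inner \<Rightarrow> real) \<Rightarrow> 'a \<Rightarrow> 'a" where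
  "gradient f x = (THE D. GDERIV f x :> D)"

lemma gradient_eqI:
  assumes "GDERIV f x :> D"
  shows "gradient f x = D"
  unfolding gradient_def
proof (rule the_equality)
  fix E assume "GDERIV f x :> E"
  with assms have "(\<lambda>h. inner h E) = (\<lambda>h. inner h D)"
    unfolding gderiv_def by (rule has_derivative_unique[rotated])
  then show "E = D"
    by (metis vector_eq_ldot)
qed (fact assms)

lemma gderiv_gradient:
  fixes f :: "'a::euclidean_space \<Rightarrow> real"
  assumes "f differentiable (at x)"
  shows "GDERIV f x :> gradient f x"
proof -
  obtain f' where f': "(f has_derivative f') (at x)"
    using assms by (auto simp: differentiable_def)
  have "f' = (\<lambda>h. inner h (adjoint f' 1))"
    using adjoint_works[OF has_derivative_linear[OF f'], of _ 1] by auto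
  with f' have "GDERIV f x :> adjoint f' 1"
    unfolding gderiv_def by metis
  then show ?thesis
    using gradient_eqI by metis
qed

text \<open>The Minkowski combination is spelled out because \<open>-\<close> on sets denotes set difference.\<close>

definition stationary_point ::
    "('a::real_inner \<Rightarrow> real) \<Rightarrow> ('a \<Rightarrow> ereal) \<Rightarrow> ('a \<Rightarrow> real) \<Rightarrow> 'a \<Rightarrow> bool" where
  "stationary_point f P1 P2 x \<longleftrightarrow>
     0 \<in> {gradient f x + v - w | v w.
            v \<in> subdifferential P1 x \<and> w \<in> subdifferential (\<lambda>z. ereal (P2 z)) x}"

text \<open>Since subtraction on \<open>nat\<close> truncates, \<open>x (t - 1)\<close> is \<open>x 0\<close> for \<open>t = 0\<close>, which is exactly the
  initialisation \<open>x\<^sup>-\<^sup>1 = x\<^sup>0\<close>.\<close>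

definition pDCAe_sequence ::
    "('a::real_inner \<Rightarrow> real) \<Rightarrow> ('a \<Rightarrow> ereal) \<Rightarrow> ('a \<Rightarrow> real) \<Rightarrow> real \<Rightarrow> (nat \<Rightarrow> real)
       \<Rightarrow> (nat \<Rightarrow> 'a) \<Rightarrow> bool" where
  "pDCAe_sequence f P1 P2 L \<beta> x \<longleftrightarrow>
     x 0 \<in> edom P1 \<and>
     (\<exists>\<xi> y. \<forall>t.
        \<xi> t \<in> subdifferential (\<lambda>z. ereal (P2 z)) (x t) \<and>
        y t = x t + \<beta> t *\<^sub>R (x t - x (t - 1)) \<and>
        is_arg_min
          (\<lambda>z. ereal (inner (gradient f (y t) - \<xi> t) z + L / 2 * (norm (z - y t))\<^sup>2) + P1 z)
          (\<lambda>_. True) (x (Suc t)))"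

end

theory Submission
  imports Defs
begin

text \<open>
  The optimality condition of the subproblem reads
  \<open>\<xi>\<^sub>t - \<nabla>f(y\<^sub>t) - L (x\<^sub>t\<^sub>+\<^sub>1 - y\<^sub>t) \<in> \<partial>P1(x\<^sub>t\<^sub>+\<^sub>1)\<close>. Added to the subgradient inequality of \<open>P2\<close>, the
  gradient inequality of \<open>f\<close> and the descent lemma for \<open>f\<close>, it gives
  \<open>F(x\<^sub>t\<^sub>+\<^sub>1) + L/2 |x\<^sub>t\<^sub>+\<^sub>1 - x\<^sub>t|\<^sup>2 \<le> F(x\<^sub>t) + L/2 \<beta>\<^sub>t\<^sup>2 |x\<^sub>t - x\<^sub>t\<^sub>-\<^sub>1|\<^sup>2\<close>. Hence
  \<open>H\<^sub>t = F(x\<^sub>t) + L/2 |x\<^sub>t - x\<^sub>t\<^sub>-\<^sub>1|\<^sup>2\<close> decreases by at least a fixed multiple of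
  \<open>|x\<^sub>t - x\<^sub>t\<^sub>-\<^sub>1|\<^sup>2\<close>. Level-boundedness of \<open>F\<close> makes \<open>x\<close> bounded, then \<open>H\<close> is bounded below, so it
  converges and the steps vanish. Along a convergent subsequence the \<open>\<xi>\<^sub>t\<close> are bounded, and the
  optimality condition passes to the limit because subdifferentials have closed graphs.
\<close>

section \<open>Tangent and descent inequalities for smooth functions\<close>

lemma GDERIV_along_line:
  assumes "GDERIV f (y + s *\<^sub>R d) :> g"
  shows "((\<lambda>s. f (y + s *\<^sub>R d)) has_real_derivative inner g d) (at s)"
proof -
  have "((\<lambda>s. y + s *\<^sub>R d) has_derivative (\<lambda>h. h *\<^sub>R d)) (at s)"
    by (auto intro!: derivative_eq_intros)
  from has_derivative_compose[OF this, of f "\<lambda>h. inner h g"] assms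
  have "((\<lambda>s. f (y + s *\<^sub>R d)) has_derivative (\<lambda>h. inner (h *\<^sub>R d) g)) (at s)"
    by (simp add: gderiv_def)
  then show ?thesis
    by (simp add: has_field_derivative_def inner_commute mult.commute[of _ "inner _ _"])
qed

text \<open>Restricting \<open>f\<close> to the line through \<open>y\<close> and \<open>z\<close>
  reduces this to the tangent inequality in one real variable.\<close>

lemma convex_on_above_gradient:
  assumes cvx: "convex_on UNIV f" and der: "GDERIV f y :> g"
  shows "f z \<ge> f y + inner g (z - y)"
proof -
  let ?\<phi> = "\<lambda>s::real. f (y + s *\<^sub>R (z - y))"
  have "convex_on UNIV ?\<phi>"
  proof (rule convex_onI)
    fix t a b :: real
    assume t: "0 < t" "t < 1"
    have "y + ((1 - t) *\<^sub>R a + t *\<^sub>R b) *\<^sub>R (z - y)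
        = (1 - t) *\<^sub>R (y + a *\<^sub>R (z - y)) + t *\<^sub>R (y + b *\<^sub>R (z - y))"
      by (simp add: algebra_simps)
    then show "?\<phi> ((1 - t) *\<^sub>R a + t *\<^sub>R b) \<le> (1 - t) * ?\<phi> a + t * ?\<phi> b"
      using convex_onD[OF cvx, of t] t by auto
  qed simp
  moreover have "(?\<phi> has_real_derivative inner g (z - y)) (at 0)"
    using GDERIV_along_line[of f y 0] der by simp
  ultimately have "?\<phi> 1 - ?\<phi> 0 \<ge> inner g (z - y) * (1 - 0)"
    by (intro convex_on_imp_above_tangent[where A = UNIV]) auto
  then show ?thesis by simp
qed

text \<open>Instead of integrating the gradient along the segment, the proof subtracts the quadratic
  model from \<open>f\<close>. By Cauchy-Schwarz and the Lipschitz bound the difference has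
  nonpositive derivative on [0, 1].\<close>

lemma descent_lemma:
  fixes f :: "'a::real_inner \<Rightarrow> real"
  assumes der: "\<And>z. GDERIV f z :> G z" and lip: "L-lipschitz_on UNIV G"
  shows "f z \<le> f y + inner (G y) (z - y) + L / 2 * (norm (z - y))\<^sup>2"
proof -
  define d where "d = z - y"
  define \<phi> where "\<phi> s = f (y + s *\<^sub>R d) - s * inner (G y) d - L / 2 * s\<^sup>2 * (norm d)\<^sup>2" for s :: real
  have "\<phi> 1 \<le> \<phi> 0"
  proof (rule DERIV_nonpos_imp_nonincreasing[where f = \<phi>])
    fix s :: real assume s: "0 \<le> s" "s \<le> 1"
    have "(\<phi> has_real_derivative
        inner (G (y + s *\<^sub>R d)) d - inner (G y) d - L * s * (norm d)\<^sup>2) (at s)"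
      unfolding \<phi>_def
      by (rule derivative_eq_intros GDERIV_along_line der refl | simp)+
    moreover have "inner (G (y + s *\<^sub>R d)) d - inner (G y) d \<le> L * s * (norm d)\<^sup>2"
    proof -
      have "inner (G (y + s *\<^sub>R d) - G y) d \<le> norm (G (y + s *\<^sub>R d) - G y) * norm d"
        by (rule norm_cauchy_schwarz)
      also have "\<dots> \<le> L * norm (s *\<^sub>R d) * norm d"
        using lipschitz_onD[OF lip, of "y + s *\<^sub>R d" y]
        by (intro mult_right_mono) (simp_all add: dist_norm)
      finally show ?thesis
        using s by (simp add: inner_diff_left power2_eq_square mult_ac)
    qed
    ultimately show "\<exists>D. (\<phi> has_real_derivative D) (at s) \<and> D \<le> 0"
      by fastforce
  qed simp
  then show ?thesis
    by (simp add: \<phi>_def d_def)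
qed

section \<open>Extended-valued convexity, subgradients and the proximal step\<close>

lemma convex_ereal_bound:
  assumes "convex_ereal h" "h x \<le> ereal p" "h u \<le> ereal q" "0 \<le> t" "t \<le> 1"
  shows "h (x + t *\<^sub>R (u - x)) \<le> ereal (p + t * (q - p))"
proof -
  have "(1 - t) *\<^sub>R (x, p) + t *\<^sub>R (u, q) \<in> {(x, r::real). h x \<le> ereal r}"
    using assms by (intro convexD) (auto simp: convex_ereal_def)
  moreover have "(1 - t) *\<^sub>R (x, p) + t *\<^sub>R (u, q) = (x + t *\<^sub>R (u - x), p + t * (q - p))"
    by (simp add: algebra_simps)
  ultimately show ?thesis by simp
qed

lemma subdifferentialD:
  assumes "v \<in> subdifferential h x" "h x = ereal p" "h u = ereal q"
  shows "p + inner v (u - x) \<le> q"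
  using assms by (auto simp: subdifferential_def dest!: spec[of _ u])

lemma subdifferential_real_iff:
  "v \<in> subdifferential (\<lambda>z. ereal (h z)) x \<longleftrightarrow> (\<forall>u. h x + inner v (u - x) \<le> h u)"
  by (auto simp: subdifferential_def algebra_simps)

lemma subdifferentialI:
  assumes ninf: "\<And>u. h u \<noteq> - \<infinity>" and hx: "h x = ereal p"
    and le: "\<And>u q. h u = ereal q \<Longrightarrow> p + inner v (u - x) \<le> q"
  shows "v \<in> subdifferential h x"
  unfolding subdifferential_def
proof (clarify)
  fix u
  show "0 \<le> h u - h x - ereal (inner v (u - x))"
    using ninf[of u] le[of u] hx by (cases "h u") (auto simp: algebra_simps)
qed

text \<open>Used for first-order conditions: after a variation is divided by its length
  \<open>t\<close>, the second-order remainder is \<open>t * b\<close> and vanishes as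
  \<open>t\<close> tends to 0 from the right.\<close>

lemma nonneg_of_nonneg_perturbation:
  fixes a b :: real
  assumes "\<And>t. 0 < t \<Longrightarrow> t \<le> 1 \<Longrightarrow> 0 \<le> a + t * b"
  shows "0 \<le> a"
proof (rule tendsto_lowerbound)
  show "((\<lambda>t. a + t * b) \<longlongrightarrow> a) (at_right 0)"
    by (auto intro!: tendsto_eq_intros)
  show "\<forall>\<^sub>F t in at_right 0. 0 \<le> a + t * b"
    using assms by (auto simp: eventually_at_right_field intro!: exI[of _ 1])
qed simp

lemma prox_argmin_finite:
  assumes "proper_fun h" and "is_arg_min (\<lambda>z. ereal (g z) + h z) (\<lambda>_. True) x"
  shows "h x < \<infinity>"
proof -
  obtain u where u: "h u < \<infinity>"
    using assms(1) by (auto simp: proper_fun_def edom_def)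
  have "ereal (g x) + h x \<le> ereal (g u) + h u"
    using assms(2) by (auto simp: is_arg_min_def not_less)
  with u show ?thesis by auto
qed

text \<open>The minimiser \<open>x\<close> is compared with \<open>x + t *\<^sub>R (u - x)\<close>.
  Convexity bounds \<open>h\<close> there by its chord and the quadratic expands exactly, so
  dividing by \<open>t\<close> and letting it tend to 0 gives the subgradient inequality without a
  sum rule.\<close>

lemma prox_argmin_subdifferential:
  fixes h :: "'a::real_inner \<Rightarrow> ereal"
  assumes proper: "proper_fun h" and cvx: "convex_ereal h"
    and min: "is_arg_min (\<lambda>z. ereal (inner c z + L / 2 * (norm (z - y))\<^sup>2) + h z) (\<lambda>_. True) x"
  shows "- c - L *\<^sub>R (x - y) \<in> subdifferential h x"
proof -
  have ninf: "h u \<noteq> - \<infinity>" for u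
    using proper by (auto simp: proper_fun_def)
  have "h x < \<infinity>"
    using prox_argmin_finite[OF proper min] .
  with ninf[of x] obtain p where hx: "h x = ereal p"
    by (cases "h x") auto
  show ?thesis
  proof (rule subdifferentialI[where h = h, OF ninf hx])
    fix u q assume hu: "h u = ereal q"
    let ?d = "u - x"
    let ?a = "q - p + inner (c + L *\<^sub>R (x - y)) ?d"
    have "0 \<le> ?a + t * (L / 2 * (norm ?d)\<^sup>2)" if t: "0 < t" "t \<le> 1" for t
    proof -
      let ?z = "x + t *\<^sub>R ?d"
      let ?g = "\<lambda>z. inner c z + L / 2 * (norm (z - y))\<^sup>2"
      have hz: "h ?z \<le> ereal (p + t * (q - p))"
        using convex_ereal_bound[OF cvx, of x p u q t] hx hu t by simp
      have "ereal (?g x) + h x \<le> ereal (?g ?z) + h ?z"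
        using min by (auto simp: is_arg_min_def not_less)
      also have "\<dots> \<le> ereal (?g ?z) + ereal (p + t * (q - p))"
        by (intro add_left_mono hz)
      finally have "?g x + p \<le> ?g ?z + (p + t * (q - p))"
        using hx by simp
      moreover have "?g ?z = ?g x + t * inner (c + L *\<^sub>R (x - y)) ?d + t * (t * (L / 2 * (norm ?d)\<^sup>2))"
      proof -
        have "?z - y = (x - y) + t *\<^sub>R ?d" by simp
        then have "(norm (?z - y))\<^sup>2
            = (norm (x - y))\<^sup>2 + 2 * t * inner (x - y) ?d + t * t * (norm ?d)\<^sup>2"
          by (simp only: power2_norm_eq_inner)
            (simp add: inner_add_left inner_add_right inner_commute algebra_simps)
        then show ?thesis
          by (simp only: inner_add_right inner_add_left inner_scaleR_left inner_scaleR_right)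
            (simp add: algebra_simps)
      qed
      ultimately have "0 \<le> t * (?a + t * (L / 2 * (norm ?d)\<^sup>2))"
        by (simp add: distrib_left)
      then show ?thesis
        using t by (simp add: zero_le_mult_iff)
    qed
    then have "0 \<le> ?a"
      by (rule nonneg_of_nonneg_perturbation)
    then show "p + inner (- c - L *\<^sub>R (x - y)) ?d \<le> q"
      by (simp add: inner_diff_left inner_add_left)
  qed
qed

section \<open>Limits and bounds of subgradients\<close>

lemma lower_semicontinuous_eventually:
  assumes "lower_semicontinuous h" "c < h a"
  shows "\<forall>\<^sub>F z in nhds a. c < h z"
proof -
  have "c < Liminf (at a) h"
    using assms by (auto simp: lower_semicontinuous_def intro: less_le_trans)
  then have "\<forall>\<^sub>F z in at a. c < h z"
    by (rule less_LiminfD)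
  \<comment> \<open>\<open>Liminf (at a) h\<close> ignores the point \<open>a\<close> itself; there
    the bound is the hypothesis \<open>c < h a\<close>.\<close>
  then show ?thesis
    using assms(2) by (auto simp: eventually_at_filter elim: eventually_mono)
qed

text \<open>The values \<open>h (x k)\<close> need not converge to \<open>h a\<close>. Lower
  semicontinuity still lets any real \<open>c\<close> below \<open>h a\<close> replace them
  eventually; the limit is taken with \<open>c\<close> fixed, and then \<open>c\<close> approaches
  \<open>h a\<close>.\<close>

lemma subdifferential_closed_graph:
  assumes proper: "proper_closed h"
    and mem: "\<And>k::nat. v k \<in> subdifferential h (x k)" and fin: "\<And>k. h (x k) < \<infinity>"
    and x: "x \<longlonglongrightarrow> a" and v: "v \<longlonglongrightarrow> w"
  shows "w \<in> subdifferential h a"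
proof -
  have ninf: "h u \<noteq> - \<infinity>" for u
    using proper by (auto simp: proper_closed_def proper_fun_def)
  have lower: "c + inner w (u - a) \<le> q" if hu: "h u = ereal q" and c: "ereal c < h a" for u q c
  proof (rule tendsto_upperbound)
    show "(\<lambda>k. c + inner (v k) (u - x k)) \<longlonglongrightarrow> c + inner w (u - a)"
      by (intro tendsto_intros x v)
    have "\<forall>\<^sub>F k in sequentially. ereal c < h (x k)"
      using proper x c lower_semicontinuous_eventually[of h "ereal c" a]
      by (auto simp: proper_closed_def dest: eventually_compose_filterlim)
    then show "\<forall>\<^sub>F k in sequentially. c + inner (v k) (u - x k) \<le> q"
    proof eventually_elim
      case (elim k)
      obtain p where "h (x k) = ereal p"
        using fin[of k] ninf[of "x k"] by (cases "h (x k)") auto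
      then show ?case
        using subdifferentialD[OF mem[of k] _ hu] elim by fastforce
    qed
  qed simp
  obtain u q where hu: "h u = ereal q"
    using proper ninf unfolding proper_closed_def proper_fun_def edom_def
    by (metis (mono_tags, lifting) empty_Collect_eq ereal_cases less_irrefl)
  \<comment> \<open>If \<open>h a\<close> were infinite, this choice of \<open>c\<close> would be
    admissible in \<open>lower\<close> and yield \<open>q + 1 \<le> q\<close>.\<close>
  have "h a \<noteq> \<infinity>"
    using lower[OF hu, of "q - inner w (u - a) + 1"] by auto
  with ninf[of a] obtain p where ha: "h a = ereal p"
    by (cases "h a") auto
  show ?thesis
  proof (rule subdifferentialI[where h = h, OF ninf ha])
    fix u q assume hu: "h u = ereal q"
    show "p + inner w (u - a) \<le> q"
    proof (rule field_le_epsilon)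
      fix e :: real assume "0 < e"
      then show "p + inner w (u - a) \<le> q + e"
        using lower[OF hu, of "p - e"] ha by simp
    qed
  qed
qed

text \<open>Testing a subgradient \<open>v\<close> at \<open>x + sgn v\<close>, at most one unit
  from \<open>x\<close>, bounds \<open>norm v\<close> by a difference of two values of
  \<open>h\<close>. Both points lie in the compact ball of radius \<open>B + 1\<close>.\<close>

lemma bounded_subgradients:
  fixes h :: "'a::euclidean_space \<Rightarrow> real"
  assumes cont: "continuous_on UNIV h" and S: "bounded S"
  shows "bounded (\<Union>x\<in>S. subdifferential (\<lambda>z. ereal (h z)) x)"
proof -
  obtain B where B: "\<And>x. x \<in> S \<Longrightarrow> norm x \<le> B"
    using S by (auto simp: bounded_iff)
  have "compact (h ` cball 0 (B + 1))"
    by (intro compact_continuous_image continuous_on_subset[OF cont]) auto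
  then obtain M where M: "\<And>z. norm z \<le> B + 1 \<Longrightarrow> \<bar>h z\<bar> \<le> M"
    by (fastforce dest!: compact_imp_bounded simp: bounded_iff)
  have "norm v \<le> 2 * M" if x: "x \<in> S" and v: "v \<in> subdifferential (\<lambda>z. ereal (h z)) x" for x v
  proof -
    have "h x + inner v (x + sgn v - x) \<le> h (x + sgn v)"
      using v unfolding subdifferential_real_iff by blast
    moreover have "inner v (x + sgn v - x) = norm v"
      by (cases "v = 0")
        (simp_all add: sgn_div_norm power2_norm_eq_inner[symmetric] power2_eq_square)
    moreover have "\<bar>h x\<bar> \<le> M" "\<bar>h (x + sgn v)\<bar> \<le> M"
      using B[OF x] norm_triangle_ineq[of x "sgn v"]
      by (auto intro!: M simp: norm_sgn split: if_splits)
    ultimately show ?thesis by linarith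
  qed
  then show ?thesis
    by (auto simp: bounded_iff)
qed

theorem theorem4p1:
  fixes f P2 :: "real ^ 'n \<Rightarrow> real"
    and P1 P F :: "real ^ 'n \<Rightarrow> ereal"
    and L :: real
    and \<beta> :: "nat \<Rightarrow> real"
    and x :: "nat \<Rightarrow> real ^ 'n"
  assumes "L > 0"
    and "convex_on UNIV f"
    and "\<forall>z. f differentiable (at z)"
    and "L-lipschitz_on UNIV (gradient f)"
    and "proper_closed P1"
    and "convex_ereal P1"
    and "continuous_on UNIV P2"
    and "convex_on UNIV P2"
    and "P = (\<lambda>z. P1 z - ereal (P2 z))"
    and "F = (\<lambda>z. ereal (f z) + P z)"
    and "level_bounded F"
    and "\<forall>t. 0 \<le> \<beta> t \<and> \<beta> t < 1"
    and "(SUP t. \<beta> t) < 1"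
    and "pDCAe_sequence f P1 P2 L \<beta> x"
  shows "bounded (range x)
    \<and> (\<lambda>t. norm (x (Suc t) - x t)) \<longlonglongrightarrow> 0
    \<and> (\<forall>a. (\<exists>r. strict_mono r \<and> (x \<circ> r) \<longlonglongrightarrow> a) \<longrightarrow> stationary_point f P1 P2 a)"
proof -
  have proper: "proper_fun P1"
    using assms(5) by (simp add: proper_closed_def)
  have ninf: "P1 z \<noteq> - \<infinity>" for z
    using proper by (auto simp: proper_fun_def)
  define G where "G = gradient f"
  have der: "GDERIV f z :> G z" for z
    using assms(3) by (simp add: G_def gderiv_gradient)
  have lip: "L-lipschitz_on UNIV G"
    using assms(4) by (simp add: G_def)
  have contG: "isCont G z" for z
    using lipschitz_on_continuous_on[OF lip] by (simp add: continuous_on_eq_continuous_at)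
  have contf: "continuous_on UNIV f"
    using assms(3) by (auto intro!: differentiable_imp_continuous_on simp: differentiable_on_def)
  obtain \<xi> y where x0: "x 0 \<in> edom P1"
    and xi: "\<And>t. \<xi> t \<in> subdifferential (\<lambda>z. ereal (P2 z)) (x t)"
    and y: "\<And>t. y t = x t + \<beta> t *\<^sub>R (x t - x (t - 1))"
    and arg: "\<And>t. is_arg_min (\<lambda>z. ereal (inner (G (y t) - \<xi> t) z + L / 2 * (norm (z - y t))\<^sup>2) + P1 z)
          (\<lambda>_. True) (x (Suc t))"
    using assms(14) unfolding pDCAe_sequence_def G_def by blast

  \<comment> \<open>Subgradients and finite objective values along the iterates\<close>
  define v where "v t = - (G (y t) - \<xi> t) - L *\<^sub>R (x (Suc t) - y t)" for t
  have v: "v t \<in> subdifferential P1 (x (Suc t))" for t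
    unfolding v_def by (rule prox_argmin_subdifferential[OF proper assms(6) arg])
  have fin: "P1 (x t) < \<infinity>" for t
    using x0 prox_argmin_finite[OF proper arg] by (cases t) (auto simp: edom_def)
  define p where "p t = real_of_ereal (P1 (x t))" for t
  have p: "P1 (x t) = ereal (p t)" for t
    using fin[of t] ninf[of "x t"] by (cases "P1 (x t)") (auto simp: p_def)
  define \<Phi> where "\<Phi> t = f (x t) + p t - P2 (x t)" for t
  have F: "F (x t) = ereal (\<Phi> t)" for t
    using assms(9,10) p by (simp add: \<Phi>_def)
  define \<delta> where "\<delta> t = (norm (x t - x (t - 1)))\<^sup>2" for t
  define b where "b = (SUP t. \<beta> t)"
  have \<beta>: "0 \<le> \<beta> t" "\<beta> t \<le> b" for t
  proof -
    \<comment> \<open>A real supremum is an upper bound only for a family that is bounded above, so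
      this comes first.\<close>
    have "bdd_above (range \<beta>)"
      using assms(12) by (auto intro!: bdd_aboveI2[of _ _ 1] less_imp_le)
    then show "\<beta> t \<le> b"
      unfolding b_def by (intro cSUP_upper) auto
  qed (use assms(12) in auto)
  have b: "0 \<le> b" "b < 1"
    using \<beta>[of 0] assms(13) by (auto simp: b_def)

  have descent: "\<Phi> (Suc t) + L / 2 * \<delta> (Suc t) \<le> \<Phi> t + L / 2 * ((\<beta> t)\<^sup>2 * \<delta> t)" for t
  proof -
    have 1: "p (Suc t) + inner (v t) (x t - x (Suc t)) \<le> p t"
      using subdifferentialD[OF v p p] .
    have 2: "P2 (x t) + inner (\<xi> t) (x (Suc t) - x t) \<le> P2 (x (Suc t))"
      using xi[of t] unfolding subdifferential_real_iff by blast
    have 3: "f (x (Suc t)) \<le> f (y t) + inner (G (y t)) (x (Suc t) - y t)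
        + L / 2 * (norm (x (Suc t) - y t))\<^sup>2"
      by (rule descent_lemma[OF der lip])
    have 4: "f (y t) + inner (G (y t)) (x t - y t) \<le> f (x t)"
      by (rule convex_on_above_gradient[OF assms(2) der])
    have "norm (x t - y t) = \<beta> t * norm (x t - x (t - 1))"
      using \<beta>[of t] by (simp add: y)
    then have 5: "(norm (x t - y t))\<^sup>2 = (\<beta> t)\<^sup>2 * \<delta> t"
      by (simp add: \<delta>_def power_mult_distrib)
    \<comment> \<open>The terms in \<open>G (y t)\<close> and \<open>\<xi> t\<close> are arranged to
      cancel against those of 2, 3 and 4. The remaining product is expanded by polarization in 7,
      whose term in \<open>x (Suc t) - y t\<close> cancels the quadratic error of the descent
      lemma.\<close>
    have 6: "inner (v t) (x t - x (Suc t)) = inner (G (y t)) (x (Suc t) - y t)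
        - inner (G (y t)) (x t - y t) - inner (\<xi> t) (x (Suc t) - x t)
        - L * inner (x (Suc t) - y t) (x t - x (Suc t))"
      by (simp add: v_def inner_diff_left inner_diff_right algebra_simps)
    have "2 * inner (x (Suc t) - y t) (x t - x (Suc t)) = (norm (x t - y t))\<^sup>2
        - (norm (x (Suc t) - y t))\<^sup>2 - \<delta> (Suc t)"
      by (simp add: \<delta>_def power2_norm_eq_inner inner_diff_left inner_diff_right
          inner_commute algebra_simps)
    then have "L / 2 * (2 * inner (x (Suc t) - y t) (x t - x (Suc t))) = L / 2 * ((\<beta> t)\<^sup>2 * \<delta> t
        - (norm (x (Suc t) - y t))\<^sup>2 - \<delta> (Suc t))"
      by (simp only: 5)
    then have 7: "L * inner (x (Suc t) - y t) (x t - x (Suc t)) = L / 2 * ((\<beta> t)\<^sup>2 * \<delta> t)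
        - L / 2 * (norm (x (Suc t) - y t))\<^sup>2 - L / 2 * \<delta> (Suc t)"
      by (simp add: right_diff_distrib)
    show ?thesis
      unfolding \<Phi>_def using 1 2 3 4 6 7 by linarith
  qed

  \<comment> \<open>The decreasing energy\<close>
  define H where "H t = \<Phi> t + L / 2 * \<delta> t" for t
  \<comment> \<open>Replacing \<open>\<beta> t\<close> by its supremum \<open>b\<close> makes the
    decrease rate independent of \<open>t\<close>; \<open>b < 1\<close> keeps it positive.\<close>
  define \<kappa> where "\<kappa> = L / 2 * (1 - b\<^sup>2)"
  have "b\<^sup>2 < 1"
    using b by (simp add: power_less_one_iff)
  then have \<kappa>: "\<kappa> > 0"
    using assms(1) by (simp add: \<kappa>_def)
  have \<delta>0: "0 \<le> \<delta> t" for t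
    by (simp add: \<delta>_def)
  have decrease: "H (Suc t) + \<kappa> * \<delta> t \<le> H t" for t
  proof -
    have "(\<beta> t)\<^sup>2 * \<delta> t \<le> b\<^sup>2 * \<delta> t"
      using \<beta>[of t] \<delta>0[of t] by (intro mult_right_mono power_mono) auto
    then have "L / 2 * ((\<beta> t)\<^sup>2 * \<delta> t) \<le> L / 2 * (b\<^sup>2 * \<delta> t)"
      using assms(1) by (intro mult_left_mono) auto
    then show ?thesis
      using descent[of t] by (simp add: H_def \<kappa>_def algebra_simps)
  qed
  have decseq: "decseq H"
  proof (rule decseq_SucI)
    fix t
    show "H (Suc t) \<le> H t"
      using decrease[of t] mult_nonneg_nonneg[OF less_imp_le[OF \<kappa>] \<delta>0[of t]] by linarith
  qed

  \<comment> \<open>Bounded iterates and a lower bound for the energy\<close>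
  have bdd: "bounded (range x)"
  proof (rule bounded_subset)
    show "bounded {z. F z \<le> ereal (H 0)}"
      using assms(11) by (simp add: level_bounded_def)
    have "\<Phi> t \<le> H 0" for t
    proof -
      have "\<Phi> t \<le> H t"
        using \<delta>0[of t] assms(1) by (simp add: H_def)
      then show ?thesis
        using decseqD[OF decseq, of 0 t] by simp
    qed
    then show "range x \<subseteq> {z. F z \<le> ereal (H 0)}"
      by (auto simp: F)
  qed

  obtain m where m: "\<And>t. m \<le> H t"
  proof -
    define K where "K = closure (range x)"
    \<comment> \<open>\<open>P1\<close> need not be continuous on \<open>K\<close>, so it is
      replaced by its affine minorant with slope \<open>v 0\<close> at \<open>x (Suc 0)\<close>. The
      resulting \<open>l\<close> is continuous and lies below the objective at every
      iterate.\<close>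
    define l where "l z = f z + (p (Suc 0) + inner (v 0) (z - x (Suc 0))) - P2 z" for z
    have "continuous_on K l"
      unfolding l_def
      by (intro continuous_intros continuous_on_subset[OF contf] continuous_on_subset[OF assms(7)]) auto
    moreover have "compact K"
      using bdd by (simp add: K_def compact_closure)
    ultimately have "bounded (l ` K)"
      by (intro compact_imp_bounded compact_continuous_image)
    then obtain B where B: "\<And>z. z \<in> K \<Longrightarrow> \<bar>l z\<bar> \<le> B"
      by (auto simp: bounded_iff)
    have "- B \<le> H t" for t
    proof -
      have "- B \<le> l (x t)"
        using B[of "x t"] closure_subset[of "range x"] by (fastforce simp: K_def)
      also have "\<dots> \<le> \<Phi> t"
        using subdifferentialD[OF v[of 0] p p[of t]] by (simp add: l_def \<Phi>_def)
      also have "\<dots> \<le> H t"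
        using \<delta>0[of t] assms(1) by (simp add: H_def)
      finally show ?thesis .
    qed
    then show ?thesis by (rule that)
  qed

  \<comment> \<open>Vanishing steps\<close>
  obtain h where h: "H \<longlonglongrightarrow> h"
    using decseq_convergent[OF decseq, of m] m by blast
  have "(\<lambda>t. (H t - H (Suc t)) / \<kappa>) \<longlonglongrightarrow> (h - h) / \<kappa>"
    using \<kappa> by (intro tendsto_intros h LIMSEQ_Suc) auto
  then have "(\<lambda>t. (H t - H (Suc t)) / \<kappa>) \<longlonglongrightarrow> 0"
    by simp
  moreover have "norm (\<delta> t) \<le> (H t - H (Suc t)) / \<kappa>" for t
    using decrease[of t] \<kappa> \<delta>0[of t] by (simp add: field_simps)
  ultimately have "\<delta> \<longlonglongrightarrow> 0"
    by (intro Lim_null_comparison[of \<delta>]) auto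
  then have "(\<lambda>t. sqrt (\<delta> t)) \<longlonglongrightarrow> sqrt 0"
    by (intro tendsto_intros)
  then have step: "(\<lambda>t. x t - x (t - 1)) \<longlonglongrightarrow> 0"
    by (simp add: \<delta>_def tendsto_norm_zero_iff)
  then have steps: "(\<lambda>t. norm (x (Suc t) - x t)) \<longlonglongrightarrow> 0"
    using LIMSEQ_Suc[OF step] by (simp add: tendsto_norm_zero_iff)

  \<comment> \<open>Stationarity of accumulation points\<close>
  have "stationary_point f P1 P2 a" if r: "strict_mono r" and lim: "(x \<circ> r) \<longlonglongrightarrow> a" for a r
  proof -
    have "bounded (range (\<xi> \<circ> r))"
      by (rule bounded_subset[OF bounded_subgradients[OF assms(7) bdd]]) (use xi in auto)
    then obtain w s where s: "strict_mono s" and w: "((\<xi> \<circ> r) \<circ> s) \<longlonglongrightarrow> w"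
      using bounded_imp_convergent_subsequence by blast
    define q where "q = r \<circ> s"
    have q: "strict_mono q"
      using r s by (simp add: q_def strict_mono_o)
    have xi_lim: "(\<lambda>k. \<xi> (q k)) \<longlonglongrightarrow> w"
      using w by (simp add: q_def o_def)
    have x_lim: "(\<lambda>k. x (q k)) \<longlonglongrightarrow> a"
      using LIMSEQ_subseq_LIMSEQ[OF lim s] by (simp add: q_def o_def)
    have "(\<lambda>k. x (Suc (q k)) - x (q k)) \<longlonglongrightarrow> 0"
      using LIMSEQ_subseq_LIMSEQ[OF steps q] by (simp add: o_def tendsto_norm_zero_iff)
    from tendsto_add[OF this x_lim] have xS_lim: "(\<lambda>k. x (Suc (q k))) \<longlonglongrightarrow> a"
      by simp
    \<comment> \<open>Since the extrapolation terms vanish, \<open>y\<close> has the same limit as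
      \<open>x\<close> along \<open>q\<close>.\<close>
    have "(\<lambda>t. \<beta> t *\<^sub>R (x t - x (t - 1))) \<longlonglongrightarrow> 0"
    proof (rule Lim_null_comparison)
      show "\<forall>\<^sub>F t in sequentially. norm (\<beta> t *\<^sub>R (x t - x (t - 1))) \<le> norm (x t - x (t - 1))"
        using assms(12) by (auto intro!: always_eventually mult_left_le_one_le simp: less_imp_le)
      show "(\<lambda>t. norm (x t - x (t - 1))) \<longlonglongrightarrow> 0"
        using step by (simp add: tendsto_norm_zero_iff)
    qed
    from tendsto_add[OF x_lim LIMSEQ_subseq_LIMSEQ[OF this q]]
    have y_lim: "(\<lambda>k. y (q k)) \<longlonglongrightarrow> a"
      by (simp add: y o_def)
    have "(\<lambda>k. v (q k)) \<longlonglongrightarrow> - (G a - w) - L *\<^sub>R (a - a)"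
      unfolding v_def
      by (intro tendsto_intros isCont_tendsto_compose[OF contG] y_lim xi_lim xS_lim)
    then have "(\<lambda>k. v (q k)) \<longlonglongrightarrow> w - G a"
      by simp
    \<comment> \<open>\<open>v (q k)\<close> is a subgradient at the next iterate
      \<open>x (Suc (q k))\<close>, hence the use of \<open>xS_lim\<close>.\<close>
    then have "w - G a \<in> subdifferential P1 a"
      using v fin by (intro subdifferential_closed_graph[OF assms(5) _ _ xS_lim]) auto
    \<comment> \<open>\<open>P2\<close> is real-valued and continuous, so its subgradient inequality
      passes to the limit directly for each fixed \<open>u\<close>.\<close>
    moreover have "w \<in> subdifferential (\<lambda>z. ereal (P2 z)) a"
      unfolding subdifferential_real_iff
    proof
      fix u
      have "isCont P2 a"
        using assms(7) by (simp add: continuous_on_eq_continuous_at)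
      then have "(\<lambda>k. P2 (x (q k)) + inner (\<xi> (q k)) (u - x (q k))) \<longlonglongrightarrow> P2 a + inner w (u - a)"
        by (intro tendsto_intros isCont_tendsto_compose[where g = P2] x_lim xi_lim)
      then show "P2 a + inner w (u - a) \<le> P2 u"
        using xi unfolding subdifferential_real_iff by (intro LIMSEQ_le_const2) auto
    qed
    ultimately show ?thesis
      unfolding stationary_point_def G_def by force
  qed
  then show ?thesis
    using bdd steps by blast
qed

end
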